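(* Let $A\in\mathbb{R}^{m\times n}$ with $m\ge n$, and apply the incremental QR algorithm described in the context to $A$ with tolerance $tol>0$. Let $R_j$ be the triangular factor at step $j$ of the algorithm, and $Q_j$ the corresponding orthonormal columns in the approximate QR factorization $A_j\approx Q_jR_j$, where $A_j$ consists of the first $j$ columns of $A$. Then $$\|A_j-Q_jR_j\|_F\le tol\cdot d_j\cdot\|R_j\|_F,$$ where $d_j$ is the number of column/row deletions that have been made up to and including step $j$. (Note that $Q_j\in\mathbb{R}^{m\times(j-d_j)}$, $R_j\in\mathbb{R}^{(j-d_j)\times j}$, and $d_n=\min\{m,n\}-k$, where $k=\mathrm{rank}(Q_nR_n)$.)
   Context: $\|\cdot\|$ is the Euclidean norm and $\|\cdot\|_F$ the Frobenius norm. MATLAB notation is used: $M(i,:)$ is row $i$ of $M$, $M(:,j)$ is column $j$, and $M(:,1:k)$ consists of the first $k$ columns. Incremental QR algorithm. Input: $A\in\mathbb{R}^{m\times n}$ and a positive scalar $tol$ controlling the accuracy of the factorization. Output: $Q$ with orthonormal columns and a rectangular matrix $R$ with $A\approx QR$. Initialization: choose $k_0\ll\min(m,n)$ and compute the QR factorization $A(:,1:k_0)=QR$, with $Q\in\mathbb{R}^{m\times k_0}$ having orthonormal columns and $R\in\mathbb{R}^{k_0\times k_0}$ upper triangular. Set the current number of columns of $Q$ to $\ell=k_0$. No deletions have been made at this point. Step $j$, for $j=k_0+1,\dots,n$: let $a=A(:,j)$, $r=Q^Ta$, $f=a-Qr$, $\rho=\|f\|$, $\mathsf{q}=f/\rho$,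 and extend the factors (Gram–Schmidt): $$Q\leftarrow[Q,\ \mathsf{q}],\qquad R\leftarrow\begin{bmatrix}R&r\\0&\rho\end{bmatrix}.$$ Let $i\in\{1,\dots,\ell+1\}$ be the index of a row of minimum Euclidean norm of the extended $R$. - If $\|R(i,:)\|^2>tol^2\,(\|R\|_F^2-\|R(i,:)\|^2)$, no deletion (deflation) is made, and $\ell\leftarrow\ell+1$. - Otherwise one column/row deletion is made: if $i<\ell+1$, row $i$ of $R$ is replaced by row $\ell+1$ of $R$ and column $i$ of $Q$ is replaced by column $\ell+1$ of $Q$; then (for any $i$) the last column of $Q$ and the last row of $R$ are removed, and $\ell$ is unchanged. The matrices $Q_j$ and $R_j$ are the matrices $Q$ and $R$ obtained at the end of step $j$ (for $j=k_0$, those of the initialization).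
   Formalization: The equality d_n = min{m,n} - rank(Q_nR_n) is stated only when A(:,1:k_0) has full column rank k_0 (it can fail otherwise); when ρ = 0, where q = f/ρ is undefined, q is any unit vector orthogonal to the columns of Q. *)

theory Defs
  imports Complex_Main "Jordan_Normal_Form.Matrix" "Jordan_Normal_Form.DL_Rank"
begin

(* Matrices and vectors are those of Jordan_Normal_Form, indexed from 0: the column
   A(:,j) of the mathematical text is "col A (j - 1)". *)

definition vec_norm2 :: "real vec \<Rightarrow> real" where
  "vec_norm2 v = sqrt (v \<bullet> v)"

definition frob_norm :: "real mat \<Rightarrow> real" where
  "frob_norm M = sqrt (\<Sum>i<dim_row M. \<Sum>j<dim_col M. (M $$ (i, j))\<^sup>2)"

definition orthonormal_cols :: "real mat \<Rightarrow> bool" where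
  "orthonormal_cols Q \<longleftrightarrow>
     (\<forall>i<dim_col Q. \<forall>j<dim_col Q. col Q i \<bullet> col Q j = (if i = j then 1 else 0))"

definition first_cols :: "'a mat \<Rightarrow> nat \<Rightarrow> 'a mat" where
  "first_cols A k = mat (dim_row A) k (\<lambda>(i, j). A $$ (i, j))"

definition is_qr :: "real mat \<Rightarrow> real mat \<Rightarrow> real mat \<Rightarrow> bool" where
  "is_qr B Q R \<longleftrightarrow>
     Q \<in> carrier_mat (dim_row B) (dim_col B) \<and> R \<in> carrier_mat (dim_col B) (dim_col B) \<and>
     orthonormal_cols Q \<and> upper_triangular R \<and> B = Q * R"

(* If rho = 0, the quotient f / rho is undefined. As the columns of Q are required to be
   orthonormal, q is in this case an arbitrary unit vector orthogonal to the columns of Q. *)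
definition gram_schmidt_extend ::
  "real mat \<Rightarrow> real mat \<Rightarrow> real vec \<Rightarrow> real mat \<Rightarrow> real mat \<Rightarrow> bool" where
  "gram_schmidt_extend Q R a Q' R' \<longleftrightarrow>
     (let r = transpose_mat Q *\<^sub>v a;
          f = a - Q *\<^sub>v r;
          \<rho> = vec_norm2 f
      in (\<exists>q \<in> carrier_vec (dim_row Q).
            (if \<rho> \<noteq> 0 then q = (1 / \<rho>) \<cdot>\<^sub>v f
             else vec_norm2 q = 1 \<and> (\<forall>c<dim_col Q. col Q c \<bullet> q = 0)) \<and>
            Q' = mat_of_cols (dim_row Q) (cols Q @ [q])) \<and>
         R' = four_block_mat R (mat_of_cols (dim_row R) [r])
                (0\<^sub>m 1 (dim_col R)) (mat 1 1 (\<lambda>_. \<rho>)))"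

definition min_norm_row :: "real mat \<Rightarrow> nat \<Rightarrow> bool" where
  "min_norm_row R i \<longleftrightarrow>
     i < dim_row R \<and> (\<forall>p<dim_row R. vec_norm2 (row R i) \<le> vec_norm2 (row R p))"

definition keeps_row :: "real \<Rightarrow> real mat \<Rightarrow> nat \<Rightarrow> bool" where
  "keeps_row tol R i \<longleftrightarrow>
     (vec_norm2 (row R i))\<^sup>2 > tol\<^sup>2 * ((frob_norm R)\<^sup>2 - (vec_norm2 (row R i))\<^sup>2)"

(* The last row (column) overwrites row (column) i and is then removed; if i is the last
   index, the overwriting has no effect. *)
definition delete_row :: "'a mat \<Rightarrow> nat \<Rightarrow> 'a mat" where
  "delete_row R i = mat_of_rows (dim_col R) (butlast ((rows R)[i := last (rows R)]))"

definition delete_col :: "'a mat \<Rightarrow> nat \<Rightarrow> 'a mat" where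
  "delete_col Q i = mat_of_cols (dim_row Q) (butlast ((cols Q)[i := last (cols Q)]))"

(* "incremental_qr A tol k\<^sub>0 j Q R d": some run of the algorithm on A with tolerance tol and
   initial block size k\<^sub>0 has the factors Q, R at the end of step j, after d deletions in total.
   It is a relation because neither the initial QR factorization nor the row of minimum norm
   is unique. *)
inductive incremental_qr ::
  "real mat \<Rightarrow> real \<Rightarrow> nat \<Rightarrow> nat \<Rightarrow> real mat \<Rightarrow> real mat \<Rightarrow> nat \<Rightarrow> bool"
  for A :: "real mat" and tol :: real and k\<^sub>0 :: nat where
  init: "k\<^sub>0 \<le> min (dim_row A) (dim_col A) \<Longrightarrow> is_qr (first_cols A k\<^sub>0) Q R \<Longrightarrow>
         incremental_qr A tol k\<^sub>0 k\<^sub>0 Q R 0"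
| keep: "incremental_qr A tol k\<^sub>0 j Q R d \<Longrightarrow> j < dim_col A \<Longrightarrow>
         gram_schmidt_extend Q R (col A j) Q' R' \<Longrightarrow>
         min_norm_row R' i \<Longrightarrow> keeps_row tol R' i \<Longrightarrow>
         incremental_qr A tol k\<^sub>0 (Suc j) Q' R' d"
| delete: "incremental_qr A tol k\<^sub>0 j Q R d \<Longrightarrow> j < dim_col A \<Longrightarrow>
         gram_schmidt_extend Q R (col A j) Q' R' \<Longrightarrow>
         min_norm_row R' i \<Longrightarrow> \<not> keeps_row tol R' i \<Longrightarrow>
         incremental_qr A tol k\<^sub>0 (Suc j) (delete_col Q' i) (delete_row R' i) (Suc d)"

end

theory Submission
  imports Defs "HOL-Analysis.L2_Norm"
begin

text \<open>
  Two facts carry the error bound. A Gram--Schmidt step reproduces the new column of \<open>A\<close> exactly, so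
  it appends a zero column to the residual \<open>A\<^sub>j - Q\<^sub>j R\<^sub>j\<close> and leaves its Frobenius norm unchanged
  (\<open>extend_residual\<close>). A deletion subtracts from \<open>Q R\<close> the outer product of a column of \<open>Q\<close>,
  which is a unit vector, and the deleted row of \<open>R\<close>; it therefore adds to the residual a matrix whose
  Frobenius norm is the norm of that row (\<open>frob_norm_deleted_part\<close>), and the deletion test bounds
  this norm by \<open>tol\<close> times the norm of the remaining rows (\<open>deleted_row_small\<close>).

  Summing these contributions gives one term \<open>tol * frob_norm R\<close> per deletion, each with the factor
  \<open>R\<close> of its own step. They can all be bounded with the current factor since \<open>frob_norm R\<close> never
  decreases. This is clear for an extension. For a deletion it is the choice of a row of minimum norm
  that matters: discarding it costs at most as much as discarding the new last row, and without the
  last row the extended factor still contains the old \<open>R\<close> (\<open>extend_keeps_leading_rows\<close>,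
  \<open>min_norm_row_removed_le\<close>).

  For the count of deletions, the rows of \<open>R\<close> stay linearly independent
  (\<open>incremental_qr_rows_independent\<close>). They are so initially, as \<open>R\<close> is square and the initial
  block is assumed to have full column rank. An extension with \<open>\<rho> \<noteq> 0\<close> preserves independence, and so does every deletion.
  If \<open>\<rho> = 0\<close>, the new row is zero and is the only zero row, so it is the row of minimum norm, fails the
  test and is deleted at once. A matrix \<open>R\<close> with independent rows has a right inverse; thus \<open>Q R\<close> has
  the same column space as \<open>Q\<close>, and its rank is the number \<open>j - d\<close> of columns of \<open>Q\<close>.
\<close>

section \<open>Rank and column space\<close>

lemma (in vec_space) mult_mat_vec_in_span_cols:
  assumes A: "A \<in> carrier_mat n nc" and v: "v \<in> carrier_vec nc"
  shows "A *\<^sub>v v \<in> span (set (cols A))"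
proof -
  have sub: "set (cols A) \<subseteq> carrier_vec n"
    using A cols_dim by blast
  have "lincomb_list (\<lambda>i. v $ i) (cols A) = mat_of_cols n (cols A) *\<^sub>v vec (length (cols A)) (\<lambda>i. v $ i)"
    by (rule lincomb_list_as_mat_mult) (use sub in auto)
  also have "\<dots> = A *\<^sub>v v"
    using A v mat_of_cols_cols[of A] by (auto intro!: arg_cong2[where f = mult_mat_vec])
  finally have "A *\<^sub>v v \<in> span_list (cols A)"
    unfolding span_list_def by (metis (mono_tags, lifting) CollectI)
  then show ?thesis
    using span_list_as_span[OF sub] by simp
qed

lemma (in vec_space) rank_mono_span:
  assumes A: "A \<in> carrier_mat n nc" and B: "B \<in> carrier_mat n nc'"
    and sub: "set (cols A) \<subseteq> span (set (cols B))"
  shows "rank A \<le> rank B"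
proof -
  have cA: "set (cols A) \<subseteq> carrier V" and cB: "set (cols B) \<subseteq> carrier V"
    using A B cols_dim by fastforce+
  have sA: "VectorSpace.subspace class_ring (span (set (cols A))) V" and sB: "VectorSpace.subspace class_ring (span (set (cols B))) V"
    using cA cB span_is_subspace by auto
  have le: "span (set (cols A)) \<subseteq> span (set (cols B))"
    using sub span_is_subset cB span_is_submodule by auto
  have nested: "VectorSpace.subspace class_ring (span (set (cols A))) (vs (span (set (cols B))))"
    using nested_subspaces[OF sB sA le] .
  interpret W: vectorspace class_ring "vs (span (set (cols B)))"
    using subspace_is_vs[OF sB] .
  have "vectorspace.dim class_ring (W.vs (span (set (cols A)))) \<le> W.dim"
    by (rule W.subspace_dim[OF nested])
      (use fin_dim_span_cols[OF A] fin_dim_span_cols[OF B] in simp_all)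
  then show ?thesis
    unfolding rank_def by simp
qed

lemma (in vec_space) rank_mult_le_left:
  assumes A: "A \<in> carrier_mat n k" and B: "B \<in> carrier_mat k nc"
  shows "rank (A * B) \<le> rank A"
proof (rule rank_mono_span)
  show "A * B \<in> carrier_mat n nc" "A \<in> carrier_mat n k"
    using A B by auto
  show "set (cols (A * B)) \<subseteq> span (set (cols A))"
  proof
    fix x assume "x \<in> set (cols (A * B))"
    then obtain c where c: "c < nc" "x = col (A * B) c"
      using A B unfolding cols_def by auto
    then have "x = A *\<^sub>v col B c"
      using A B by (auto simp: mult_mat_vec_def)
    then show "x \<in> span (set (cols A))"
      using mult_mat_vec_in_span_cols[OF A] c B by auto
  qed
qed

text \<open>
  Coefficient vectors describe linear combinations of the \<^emph>\<open>set\<close> of columns faithfully only if no column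
  is repeated. Full rank excludes repetitions: the span does not change when duplicates are removed,
  but fewer columns then bound its dimension.
\<close>
lemma (in vec_space) full_col_rank_injective:
  assumes A: "A \<in> carrier_mat n nc" and rank: "rank A = nc"
    and v: "v \<in> carrier_vec nc" and zero: "A *\<^sub>v v = 0\<^sub>v n"
  shows "v = 0\<^sub>v nc"
proof -
  have "distinct (cols A)"
  proof (rule ccontr)
    assume nd: "\<not> distinct (cols A)"
    let ?B = "mat_of_cols n (remdups (cols A))"
    have sub: "set (remdups (cols A)) \<subseteq> carrier_vec n"
      using A cols_dim by fastforce
    have "rank ?B = rank A"
      unfolding rank_def using cols_mat_of_cols[OF sub] by simp
    moreover have "rank ?B \<le> length (remdups (cols A))"
      by (rule rank_le_nc) simp
    moreover have "length (remdups (cols A)) < length (cols A)"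
      using nd length_remdups_leq[of "cols A"] length_remdups_eq[of "cols A"]
      by (metis distinct_remdups nat_less_le)
    ultimately show False
      using rank A by simp
  qed
  then show ?thesis
    using lin_depI[OF A v _ zero] full_rank_lin_indpt[OF A rank] by blast
qed

lemma (in vec_space) injective_full_col_rank:
  assumes A: "A \<in> carrier_mat n nc"
    and inj: "\<And>v. v \<in> carrier_vec nc \<Longrightarrow> A *\<^sub>v v = 0\<^sub>v n \<Longrightarrow> v = 0\<^sub>v nc"
  shows "rank A = nc"
proof (rule lin_indpt_full_rank[OF A])
  show d: "distinct (cols A)"
    unfolding distinct_conv_nth
  proof (intro allI impI notI)
    fix a b assume ab: "a < length (cols A)" "b < length (cols A)" "a \<noteq> b" "cols A ! a = cols A ! b"
    let ?v = "unit_vec nc a - unit_vec nc b :: 'a vec"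
    have ab': "a < nc" "b < nc" "col A a = col A b"
      using ab A by auto
    have "A *\<^sub>v ?v = A *\<^sub>v unit_vec nc a - A *\<^sub>v unit_vec nc b"
      by (rule mult_minus_distrib_mat_vec[OF A]) auto
    also have "\<dots> = 0\<^sub>v n"
    proof -
      have "A *\<^sub>v unit_vec nc e = col A e" if "e < nc" for e
        using that A by (intro eq_vecI) (auto simp: scalar_prod_right_unit)
      then show ?thesis
        using ab' A by auto
    qed
    finally have "?v = 0\<^sub>v nc"
      using inj by simp
    then have "?v $ a = 0"
      using ab' by simp
    then show False
      using ab' ab by simp
  qed
  show "lin_indpt (set (cols A))"
    using lin_depE[OF A _ d] inj by metis
qed

section \<open>Euclidean and Frobenius norms\<close>

lemma vec_norm2_sq: "(vec_norm2 v)\<^sup>2 = v \<bullet> v"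
  unfolding vec_norm2_def by (simp add: scalar_prod_def sum_nonneg)

lemma vec_norm2_nonneg: "0 \<le> vec_norm2 v"
  by (simp add: vec_norm2_def scalar_prod_def sum_nonneg)

lemma vec_norm2_eq_0_iff: "vec_norm2 v = 0 \<longleftrightarrow> v = 0\<^sub>v (dim_vec v)"
proof
  assume "vec_norm2 v = 0"
  then have "(\<Sum>p\<in>{0..<dim_vec v}. v $ p * v $ p) = 0"
    unfolding vec_norm2_def by (simp add: scalar_prod_def)
  then show "v = 0\<^sub>v (dim_vec v)"
    by (intro eq_vecI) (auto simp: sum_nonneg_eq_0_iff)
next
  assume "v = 0\<^sub>v (dim_vec v)"
  then show "vec_norm2 v = 0"
    unfolding vec_norm2_def by (metis carrier_vecI real_sqrt_zero scalar_prod_right_zero)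
qed

lemma vec_norm2_row_sq:
  "p < dim_row R \<Longrightarrow> (vec_norm2 (row R p))\<^sup>2 = (\<Sum>y<dim_col R. (R $$ (p, y))\<^sup>2)"
  unfolding vec_norm2_sq by (simp add: scalar_prod_def power2_eq_square atLeast0LessThan)

lemma frob_norm_nonneg: "0 \<le> frob_norm M"
  unfolding frob_norm_def by (simp add: sum_nonneg)

lemma frob_norm_sq: "(frob_norm M)\<^sup>2 = (\<Sum>x<dim_row M. \<Sum>y<dim_col M. (M $$ (x, y))\<^sup>2)"
  unfolding frob_norm_def by (simp add: sum_nonneg)

lemma frob_norm_sq_rows: "(frob_norm M)\<^sup>2 = (\<Sum>x<dim_row M. (vec_norm2 (row M x))\<^sup>2)"
  unfolding frob_norm_sq by (intro sum.cong refl) (simp add: vec_norm2_row_sq)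

text \<open>
  The Frobenius norm is the Euclidean norm of the family of all entries, and inherits the triangle
  inequality from there.
\<close>
lemma frob_norm_triangle:
  assumes X: "X \<in> carrier_mat a b" and Y: "Y \<in> carrier_mat a b"
  shows "frob_norm (X + Y) \<le> frob_norm X + frob_norm Y"
proof -
  let ?S = "{..<a} \<times> {..<b}"
  have L2: "frob_norm M = L2_set (\<lambda>p. M $$ p) ?S" if "M \<in> carrier_mat a b" for M
    using that unfolding frob_norm_def L2_set_def by (simp add: sum.cartesian_product)
  have "frob_norm (X + Y) = L2_set (\<lambda>p. (X + Y) $$ p) ?S"
    using X Y by (intro L2) simp
  also have "\<dots> = L2_set (\<lambda>p. X $$ p + Y $$ p) ?S"
    using X Y by (intro L2_set_cong) auto
  also have "\<dots> \<le> L2_set (\<lambda>p. X $$ p) ?S + L2_set (\<lambda>p. Y $$ p) ?S"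
    by (rule L2_set_triangle_ineq)
  finally show ?thesis
    using L2 X Y by simp
qed

lemma index_mult_mat_sum:
  assumes "X \<in> carrier_mat a b" "Y \<in> carrier_mat b c" "x < a" "y < c"
  shows "(X * Y) $$ (x, y) = (\<Sum>p<b. X $$ (x, p) * Y $$ (p, y))"
  using assms by (simp add: scalar_prod_def atLeast0LessThan)

section \<open>Gram--Schmidt extension\<close>

lemma transpose_mult_orthonormal:
  assumes Q: "Q \<in> carrier_mat m l" and o: "orthonormal_cols Q"
  shows "transpose_mat Q * Q = 1\<^sub>m l"
  using Q o by (intro eq_matI) (auto simp: orthonormal_cols_def)

lemma gram_schmidt_residual_orthogonal:
  fixes a :: "real vec"
  assumes Q: "Q \<in> carrier_mat m l" and a: "a \<in> carrier_vec m" and o: "orthonormal_cols Q"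
    and c: "c < l"
  shows "col Q c \<bullet> (a - Q *\<^sub>v (transpose_mat Q *\<^sub>v a)) = 0"
proof -
  have "transpose_mat Q *\<^sub>v (a - Q *\<^sub>v (transpose_mat Q *\<^sub>v a))
      = transpose_mat Q *\<^sub>v a - transpose_mat Q *\<^sub>v (Q *\<^sub>v (transpose_mat Q *\<^sub>v a))"
    by (rule mult_minus_distrib_mat_vec) (use Q a in auto)
  also have "transpose_mat Q *\<^sub>v (Q *\<^sub>v (transpose_mat Q *\<^sub>v a)) = (transpose_mat Q * Q) *\<^sub>v (transpose_mat Q *\<^sub>v a)"
    by (rule assoc_mult_mat_vec[symmetric]) (use Q a in auto)
  also have "\<dots> = transpose_mat Q *\<^sub>v a"
    using transpose_mult_orthonormal[OF Q o] Q a by simp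
  finally have "(transpose_mat Q *\<^sub>v (a - Q *\<^sub>v (transpose_mat Q *\<^sub>v a))) $ c = 0"
    using Q a c by simp
  then show ?thesis
    using Q a c by simp
qed

text \<open>
  An entrywise description of the extended factors that treats \<open>\<rho> \<noteq> 0\<close> and \<open>\<rho> = 0\<close> alike. In both cases
  \<open>q\<close> is a unit vector orthogonal to the columns of \<open>Q\<close>, by normalisation or by choice, and \<open>\<rho> q\<close> is
  the residual of \<open>a\<close>, which vanishes if \<open>\<rho> = 0\<close>.
\<close>
lemma gram_schmidt_extendE:
  assumes ext: "gram_schmidt_extend Q R a Q' R'"
    and Q: "Q \<in> carrier_mat m l" and R: "R \<in> carrier_mat l j" and a: "a \<in> carrier_vec m"
    and o: "orthonormal_cols Q"
  obtains q r \<rho> where "Q' \<in> carrier_mat m (Suc l)" "R' \<in> carrier_mat (Suc l) (Suc j)"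
    "orthonormal_cols Q'" "Q *\<^sub>v r + \<rho> \<cdot>\<^sub>v q = a" "r \<in> carrier_vec l" "q \<in> carrier_vec m"
    "\<forall>x<m. \<forall>c<Suc l. Q' $$ (x, c) = (if c < l then Q $$ (x, c) else q $ x)"
    "\<forall>c<Suc l. \<forall>y<Suc j. R' $$ (c, y) =
       (if c < l then if y < j then R $$ (c, y) else r $ c else if y < j then 0 else \<rho>)"
proof -
  define r where "r = transpose_mat Q *\<^sub>v a"
  define f where "f = a - Q *\<^sub>v r"
  define \<rho> where "\<rho> = vec_norm2 f"
  have r: "r \<in> carrier_vec l" and f: "f \<in> carrier_vec m"
    using Q a by (auto simp: r_def f_def)
  from ext obtain q where q: "q \<in> carrier_vec m"
    and qdef: "if \<rho> \<noteq> 0 then q = (1 / \<rho>) \<cdot>\<^sub>v f else vec_norm2 q = 1 \<and> (\<forall>c<l. col Q c \<bullet> q = 0)"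
    and Q'def: "Q' = mat_of_cols m (cols Q @ [q])"
    and R'def: "R' = four_block_mat R (mat_of_cols l [r]) (0\<^sub>m 1 j) (mat 1 1 (\<lambda>_. \<rho>))"
    using Q R unfolding gram_schmidt_extend_def Let_def r_def[symmetric] f_def[symmetric] \<rho>_def[symmetric]
    by auto
  have \<rho>f: "\<rho> \<cdot>\<^sub>v q = f"
  proof (cases "\<rho> = 0")
    case True
    then have "f = 0\<^sub>v m"
      using vec_norm2_eq_0_iff[of f] f by (simp add: \<rho>_def)
    then show ?thesis
      using True q by (intro eq_vecI) auto
  next
    case False
    then show ?thesis
      using qdef f by (simp add: smult_smult_assoc)
  qed
  have unit: "q \<bullet> q = 1"
  proof (cases "\<rho> = 0")
    case True
    then show ?thesis
      using qdef vec_norm2_sq[of q] by simp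
  next
    case False
    then have "q \<bullet> q = (1 / \<rho>) * ((1 / \<rho>) * (f \<bullet> f))"
      using qdef f by simp
    also have "f \<bullet> f = \<rho>\<^sup>2"
      unfolding \<rho>_def vec_norm2_sq ..
    finally show ?thesis
      using False by (simp add: power2_eq_square)
  qed
  have orth: "col Q c \<bullet> q = 0" if "c < l" for c
  proof (cases "\<rho> = 0")
    case True
    then show ?thesis
      using qdef that by simp
  next
    case False
    have "col Q c \<bullet> f = 0"
      unfolding f_def r_def by (rule gram_schmidt_residual_orthogonal[OF Q a o that])
    then show ?thesis
      using False qdef f Q by simp
  qed
  have Q': "Q' \<in> carrier_mat m (Suc l)"
    using Q by (auto simp: Q'def)
  have Q'col: "col Q' c = (if c < l then col Q c else q)" if "c < Suc l" for c
    unfolding Q'def using Q q that by (subst col_mat_of_cols) (auto simp: nth_append)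
  show thesis
  proof (rule that[OF Q' _ _ _ r q])
    show "R' \<in> carrier_mat (Suc l) (Suc j)"
      using R by (auto simp: R'def)
    show "orthonormal_cols Q'"
      unfolding orthonormal_cols_def
    proof (intro allI impI)
      fix b c assume bc: "b < dim_col Q'" "c < dim_col Q'"
      then have "b < Suc l" "c < Suc l" using Q' by auto
      moreover have "q \<bullet> col Q b = 0" if "b < l" for b
        using orth[OF that] comm_scalar_prod[OF q, of "col Q b"] Q that by auto
      ultimately show "col Q' b \<bullet> col Q' c = (if b = c then 1 else 0)"
        using o Q orth unit by (auto simp: Q'col orthonormal_cols_def)
    qed
    show "Q *\<^sub>v r + \<rho> \<cdot>\<^sub>v q = a"
      unfolding \<rho>f using Q r a by (intro eq_vecI) (auto simp: f_def)
    show "\<forall>x<m. \<forall>c<Suc l. Q' $$ (x, c) = (if c < l then Q $$ (x, c) else q $ x)"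
    proof (intro allI impI)
      fix x c assume that: "x < m" "c < Suc l"
      have "Q' $$ (x, c) = col Q' c $ x"
        using Q' that by simp
      then show "Q' $$ (x, c) = (if c < l then Q $$ (x, c) else q $ x)"
        using Q'col[OF that(2)] Q that by auto
    qed
    show "\<forall>c<Suc l. \<forall>y<Suc j. R' $$ (c, y) =
        (if c < l then if y < j then R $$ (c, y) else r $ c else if y < j then 0 else \<rho>)"
      using R r by (auto simp: R'def mat_of_cols_index)
  qed
qed

corollary gram_schmidt_extend_shape:
  assumes ext: "gram_schmidt_extend Q R a Q' R'"
    and Q: "Q \<in> carrier_mat m l" and R: "R \<in> carrier_mat l j" and a: "a \<in> carrier_vec m"
    and o: "orthonormal_cols Q"
  shows "Q' \<in> carrier_mat m (Suc l)" and "R' \<in> carrier_mat (Suc l) (Suc j)"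
    and "orthonormal_cols Q'"
    and "\<And>c y. c < l \<Longrightarrow> y < j \<Longrightarrow> R' $$ (c, y) = R $$ (c, y)"
  by (rule gram_schmidt_extendE[OF ext Q R a o]; simp)+

text \<open>
  The first \<open>j\<close> columns of \<open>Q' R'\<close> are those of \<open>Q R\<close> because the new row of \<open>R'\<close> is zero there, and the
  last column is \<open>Q r + \<rho> q\<close>, which is the new column of \<open>A\<close>.
\<close>
lemma extend_residual:
  assumes ext: "gram_schmidt_extend Q R (col A j) Q' R'"
    and A: "A \<in> carrier_mat m n" and jn: "j < n"
    and Q: "Q \<in> carrier_mat m l" and R: "R \<in> carrier_mat l j" and o: "orthonormal_cols Q"
  shows "frob_norm (first_cols A (Suc j) - Q' * R') = frob_norm (first_cols A j - Q * R)"
proof -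
  have a: "col A j \<in> carrier_vec m" using A jn by auto
  obtain q r \<rho> where
    Q': "Q' \<in> carrier_mat m (Suc l)" and R': "R' \<in> carrier_mat (Suc l) (Suc j)"
    and "orthonormal_cols Q'" and split: "Q *\<^sub>v r + \<rho> \<cdot>\<^sub>v q = col A j" and r: "r \<in> carrier_vec l" and q: "q \<in> carrier_vec m"
    and Q'i: "\<forall>x<m. \<forall>c<Suc l. Q' $$ (x, c) = (if c < l then Q $$ (x, c) else q $ x)"
    and R'i: "\<forall>c<Suc l. \<forall>y<Suc j. R' $$ (c, y) =
       (if c < l then if y < j then R $$ (c, y) else r $ c else if y < j then 0 else \<rho>)"
    by (rule gram_schmidt_extendE[OF ext Q R a o]) (rule that; assumption)
  have old: "(first_cols A (Suc j) - Q' * R') $$ (x, y) = (first_cols A j - Q * R) $$ (x, y)"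
    if "x < m" "y < j" for x y
    using that A Q R Q' R'
    by (simp add: first_cols_def index_mult_mat_sum[OF Q R] index_mult_mat_sum[OF Q' R'] Q'i R'i del: index_mult_mat(1))
  have new: "(first_cols A (Suc j) - Q' * R') $$ (x, j) = 0" if "x < m" for x
  proof -
    have "A $$ (x, j) = (Q *\<^sub>v r + \<rho> \<cdot>\<^sub>v q) $ x"
      using that A jn unfolding split by simp
    also have "\<dots> = (\<Sum>c<l. Q $$ (x, c) * r $ c) + q $ x * \<rho>"
      using that Q r q by (simp add: scalar_prod_def atLeast0LessThan)
    finally show ?thesis
      using that A Q' R'
      by (simp add: first_cols_def index_mult_mat_sum[OF Q' R'] Q'i R'i del: index_mult_mat(1))
  qed
  have "(\<Sum>y<Suc j. ((first_cols A (Suc j) - Q' * R') $$ (x, y))\<^sup>2) = (\<Sum>y<j. ((first_cols A j - Q * R) $$ (x, y))\<^sup>2)"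
    if "x < m" for x
    unfolding sum.lessThan_Suc new[OF that] using old[OF that] by simp
  then show ?thesis
    using A Q R Q' R' unfolding frob_norm_def by simp
qed

lemma extend_keeps_leading_rows:
  fixes R R' :: "real mat"
  assumes R: "R \<in> carrier_mat l j" and R': "R' \<in> carrier_mat (Suc l) (Suc j)"
    and ext: "\<And>c y. c < l \<Longrightarrow> y < j \<Longrightarrow> R' $$ (c, y) = R $$ (c, y)"
  shows "(frob_norm R)\<^sup>2 \<le> (\<Sum>c<l. (vec_norm2 (row R' c))\<^sup>2)"
proof -
  have "(vec_norm2 (row R c))\<^sup>2 \<le> (vec_norm2 (row R' c))\<^sup>2" if "c < l" for c
    using that R R' ext by (simp add: vec_norm2_row_sq)
  then show ?thesis
    using R unfolding frob_norm_sq_rows by (auto intro!: sum_mono)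
qed

section \<open>Deletion of a row and a column\<close>

text \<open>
  Position \<open>c\<close> after a deletion holds what was at position \<open>moved_index l i c\<close> before. For \<open>i \<le> l\<close> this map is a
  bijection from \<open>{..<l}\<close> onto \<open>{..<Suc l} - {i}\<close>, even if \<open>i = l\<close>, so that sums over the
  remaining indices need no case distinction.
\<close>
definition moved_index :: "nat \<Rightarrow> nat \<Rightarrow> nat \<Rightarrow> nat" where
  "moved_index l i c = (if c = i then l else c)"

lemma sum_moved_index:
  fixes g :: "nat \<Rightarrow> 'a :: ab_group_add"
  assumes "i < Suc l"
  shows "(\<Sum>c<l. g (moved_index l i c)) = (\<Sum>c<Suc l. g c) - g i"
proof -
  have "(\<Sum>c<l. g (moved_index l i c)) = (\<Sum>c\<in>{..<Suc l} - {i}. g c)"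
    using assms
    by (intro sum.reindex_bij_witness[where i = "\<lambda>c. if c = l then i else c" and j = "moved_index l i"])
      (auto simp: moved_index_def split: if_splits)
  then show ?thesis
    using assms by (simp add: sum_diff1)
qed

lemma moved_index_less: "c < l \<Longrightarrow> moved_index l i c < Suc l"
  by (simp add: moved_index_def)

lemma delete_col_carrier:
  "Q \<in> carrier_mat m (Suc l) \<Longrightarrow> delete_col Q i \<in> carrier_mat m l"
  unfolding delete_col_def by (auto simp: mat_of_cols_def)

lemma delete_row_carrier:
  "R \<in> carrier_mat (Suc l) j \<Longrightarrow> delete_row R i \<in> carrier_mat l j"
  unfolding delete_row_def by (auto simp: mat_of_rows_def)

lemma col_delete_col:
  assumes "Q \<in> carrier_mat m (Suc l)" "c < l"
  shows "col (delete_col Q i) c = col Q (moved_index l i c)"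
proof -
  have "cols Q \<noteq> []"
    using assms by (auto simp flip: length_greater_0_conv)
  then have "last (cols Q) = col Q l"
    using assms by (simp add: last_conv_nth)
  then show ?thesis
    using assms unfolding delete_col_def moved_index_def
    by (intro eq_vecI) (auto simp: nth_butlast nth_list_update mat_of_cols_index)
qed

lemma row_delete_row:
  assumes "R \<in> carrier_mat (Suc l) j" "c < l"
  shows "row (delete_row R i) c = row R (moved_index l i c)"
proof -
  have "rows R \<noteq> []"
    using assms by (auto simp flip: length_greater_0_conv)
  then have "last (rows R) = row R l"
    using assms by (simp add: last_conv_nth)
  then show ?thesis
    using assms unfolding delete_row_def moved_index_def
    by (intro eq_vecI) (auto simp: nth_butlast nth_list_update mat_of_rows_index)
qed

lemma index_delete_col:
  assumes "Q \<in> carrier_mat m (Suc l)" "c < l" "x < m"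
  shows "delete_col Q i $$ (x, c) = Q $$ (x, moved_index l i c)"
  using arg_cong[OF col_delete_col[OF assms(1,2)], of "\<lambda>v. v $ x" i] assms
    delete_col_carrier[OF assms(1), of i] moved_index_less[OF assms(2), of i] by simp

lemma index_delete_row:
  assumes "R \<in> carrier_mat (Suc l) j" "c < l" "y < j"
  shows "delete_row R i $$ (c, y) = R $$ (moved_index l i c, y)"
  using arg_cong[OF row_delete_row[OF assms(1,2)], of "\<lambda>v. v $ y" i] assms
    delete_row_carrier[OF assms(1), of i] moved_index_less[OF assms(2), of i] by simp

lemma orthonormal_delete_col:
  assumes Q: "Q \<in> carrier_mat m (Suc l)" and o: "orthonormal_cols Q"
  shows "orthonormal_cols (delete_col Q i)"
  unfolding orthonormal_cols_def
proof (intro allI impI)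
  fix b c assume "b < dim_col (delete_col Q i)" "c < dim_col (delete_col Q i)"
  then have bc: "b < l" "c < l"
    using delete_col_carrier[OF Q, of i] by auto
  then have "moved_index l i b = moved_index l i c \<longleftrightarrow> b = c"
    by (auto simp: moved_index_def)
  then show "col (delete_col Q i) b \<bullet> col (delete_col Q i) c = (if b = c then 1 else 0)"
    using o Q bc moved_index_less unfolding orthonormal_cols_def
    by (simp add: col_delete_col[OF Q])
qed

lemma frob_norm_delete_row:
  assumes R: "R \<in> carrier_mat (Suc l) j" and i: "i < Suc l"
  shows "(frob_norm (delete_row R i))\<^sup>2 = (frob_norm R)\<^sup>2 - (vec_norm2 (row R i))\<^sup>2"
proof -
  have "(frob_norm (delete_row R i))\<^sup>2 = (\<Sum>c<l. (vec_norm2 (row R (moved_index l i c)))\<^sup>2)"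
    using delete_row_carrier[OF R, of i] by (simp add: frob_norm_sq_rows row_delete_row[OF R])
  then show ?thesis
    using R sum_moved_index[OF i, of "\<lambda>c. (vec_norm2 (row R c))\<^sup>2"] by (simp add: frob_norm_sq_rows)
qed

text \<open>
  The difference of the two products is the outer product of column \<open>i\<close> of \<open>Q\<close> and row \<open>i\<close> of \<open>R\<close>. The
  Frobenius norm of an outer product is the product of the norms of its factors, and the column is a
  unit vector.
\<close>
lemma frob_norm_deleted_part:
  assumes Q: "Q \<in> carrier_mat m (Suc l)" and R: "R \<in> carrier_mat (Suc l) j"
    and o: "orthonormal_cols Q" and i: "i < Suc l"
  shows "frob_norm (Q * R - delete_col Q i * delete_row R i) = vec_norm2 (row R i)"
proof -
  let ?D = "Q * R - delete_col Q i * delete_row R i"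
  note dQ = delete_col_carrier[OF Q, of i] and dR = delete_row_carrier[OF R, of i]
  have D: "?D \<in> carrier_mat m j"
    using Q R dQ dR by auto
  have "?D $$ (x, y) = Q $$ (x, i) * R $$ (i, y)" if "x < m" "y < j" for x y
    using that Q R dQ dR sum_moved_index[OF i, of "\<lambda>c. Q $$ (x, c) * R $$ (c, y)"]
    by (simp add: index_mult_mat_sum[OF Q R] index_mult_mat_sum[OF dQ dR] index_delete_col[OF Q]
        index_delete_row[OF R] del: index_mult_mat(1))
  then have "(frob_norm ?D)\<^sup>2 = (\<Sum>x<m. \<Sum>y<j. (Q $$ (x, i) * R $$ (i, y))\<^sup>2)"
    using D unfolding frob_norm_sq by (auto intro!: sum.cong simp del: index_minus_mat)
  also have "\<dots> = (\<Sum>x<m. (Q $$ (x, i))\<^sup>2) * (\<Sum>y<j. (R $$ (i, y))\<^sup>2)"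
    by (simp add: power_mult_distrib sum_product)
  also have "(\<Sum>x<m. (Q $$ (x, i))\<^sup>2) = col Q i \<bullet> col Q i"
    using Q i by (simp add: scalar_prod_def power2_eq_square atLeast0LessThan)
  also have "\<dots> = 1"
    using o Q i by (simp add: orthonormal_cols_def)
  finally have "(frob_norm ?D)\<^sup>2 = (vec_norm2 (row R i))\<^sup>2"
    using R i by (simp add: vec_norm2_row_sq)
  then show ?thesis
    by (rule power2_eq_imp_eq)
      (rule frob_norm_nonneg vec_norm2_nonneg)+
qed

section \<open>Accumulation of the error\<close>

text \<open>
  Among all rows, removing one of minimum norm leaves the most; in particular no less than removing
  the last one.
\<close>
lemma min_norm_row_removed_le:
  assumes R: "R \<in> carrier_mat (Suc l) j" and i: "min_norm_row R i"
  shows "(\<Sum>c<l. (vec_norm2 (row R c))\<^sup>2) \<le> (frob_norm (delete_row R i))\<^sup>2"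
proof -
  have "i < Suc l" and "vec_norm2 (row R i) \<le> vec_norm2 (row R l)"
    using i R by (auto simp: min_norm_row_def)
  then have "(vec_norm2 (row R i))\<^sup>2 \<le> (vec_norm2 (row R l))\<^sup>2"
    by (intro power_mono vec_norm2_nonneg)
  then show ?thesis
    using R frob_norm_delete_row[OF R \<open>i < Suc l\<close>] by (simp add: frob_norm_sq_rows)
qed

text \<open>
  The deletion test compares the row with all the others, and these are exactly the rows that are left.
\<close>
lemma deleted_row_small:
  assumes R: "R \<in> carrier_mat (Suc l) j" and i: "i < Suc l"
    and small: "\<not> keeps_row tol R i" and tol: "0 < tol"
  shows "vec_norm2 (row R i) \<le> tol * frob_norm (delete_row R i)"
proof -
  have "(vec_norm2 (row R i))\<^sup>2 \<le> (tol * frob_norm (delete_row R i))\<^sup>2"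
    using small unfolding keeps_row_def power_mult_distrib frob_norm_delete_row[OF R i] by simp
  then show ?thesis
    by (rule power2_le_imp_le) (use tol frob_norm_nonneg in auto)
qed

lemma incremental_qr_invariant:
  assumes run: "incremental_qr A tol k\<^sub>0 j Q R d"
    and A: "A \<in> carrier_mat m n" and tol: "0 < tol"
  shows "j \<le> n \<and> d \<le> j \<and> Q \<in> carrier_mat m (j - d) \<and> R \<in> carrier_mat (j - d) j
    \<and> orthonormal_cols Q
    \<and> frob_norm (first_cols A j - Q * R) \<le> tol * real d * frob_norm R"
  using run
proof induction
  case (init Q R)
  then have Q: "Q \<in> carrier_mat m k\<^sub>0" and R: "R \<in> carrier_mat k\<^sub>0 k\<^sub>0" and "orthonormal_cols Q"
    and eq: "first_cols A k\<^sub>0 = Q * R" and "k\<^sub>0 \<le> n"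
    using A by (auto simp: is_qr_def first_cols_def)
  moreover have "frob_norm (first_cols A k\<^sub>0 - Q * R) = 0"
    using Q R unfolding eq by (simp add: frob_norm_def del: index_mult_mat(1))
  ultimately show ?case
    by simp
next
  case (keep j Q R d Q' R' i)
  let ?l = "j - d"
  have jn: "j < n" using keep A by simp
  have Q: "Q \<in> carrier_mat m ?l" and R: "R \<in> carrier_mat ?l j" and o: "orthonormal_cols Q"
    and d: "d \<le> j" and err: "frob_norm (first_cols A j - Q * R) \<le> tol * real d * frob_norm R"
    using keep.IH by auto
  have a: "col A j \<in> carrier_vec m" using A jn by auto
  note Q' = gram_schmidt_extend_shape(1)[OF keep.hyps(3) Q R a o]
    and R' = gram_schmidt_extend_shape(2)[OF keep.hyps(3) Q R a o]
    and o' = gram_schmidt_extend_shape(3)[OF keep.hyps(3) Q R a o]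
    and lead = gram_schmidt_extend_shape(4)[OF keep.hyps(3) Q R a o]
  have "(frob_norm R)\<^sup>2 \<le> (\<Sum>c<?l. (vec_norm2 (row R' c))\<^sup>2)"
    by (rule extend_keeps_leading_rows[OF R R' lead])
  also have "\<dots> \<le> (frob_norm R')\<^sup>2"
    using R' by (simp add: frob_norm_sq_rows)
  finally have "frob_norm R \<le> frob_norm R'"
    by (rule power2_le_imp_le) (rule frob_norm_nonneg)
  then have "tol * real d * frob_norm R \<le> tol * real d * frob_norm R'"
    using tol by (intro mult_left_mono) auto
  then show ?case
    using jn d Q' R' o' err extend_residual[OF keep.hyps(3) A jn Q R o]
    by (simp add: Suc_diff_le)
next
  case (delete j Q R d Q' R' i)
  let ?l = "j - d" and ?Q'' = "delete_col Q' i" and ?R'' = "delete_row R' i"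
  have jn: "j < n" using delete A by simp
  have Q: "Q \<in> carrier_mat m ?l" and R: "R \<in> carrier_mat ?l j" and o: "orthonormal_cols Q"
    and d: "d \<le> j" and err: "frob_norm (first_cols A j - Q * R) \<le> tol * real d * frob_norm R"
    using delete.IH by auto
  have a: "col A j \<in> carrier_vec m" using A jn by auto
  note Q' = gram_schmidt_extend_shape(1)[OF delete.hyps(3) Q R a o]
    and R' = gram_schmidt_extend_shape(2)[OF delete.hyps(3) Q R a o]
    and o' = gram_schmidt_extend_shape(3)[OF delete.hyps(3) Q R a o]
    and lead = gram_schmidt_extend_shape(4)[OF delete.hyps(3) Q R a o]
  note Q'' = delete_col_carrier[OF Q', of i] and R'' = delete_row_carrier[OF R', of i]
  have i: "i < Suc ?l"
    using delete.hyps(4) R' by (simp add: min_norm_row_def)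
  have "(frob_norm R)\<^sup>2 \<le> (frob_norm ?R'')\<^sup>2"
    using extend_keeps_leading_rows[OF R R' lead] min_norm_row_removed_le[OF R' delete.hyps(4)]
    by (rule order_trans)
  then have "frob_norm R \<le> frob_norm ?R''"
    by (rule power2_le_imp_le) (rule frob_norm_nonneg)
  then have mono: "tol * real d * frob_norm R \<le> tol * real d * frob_norm ?R''"
    using tol by (intro mult_left_mono) auto
  let ?E = "first_cols A (Suc j) - Q' * R'" and ?D = "Q' * R' - ?Q'' * ?R''"
  have E: "?E \<in> carrier_mat m (Suc j)" and D: "?D \<in> carrier_mat m (Suc j)"
    using A Q' R' Q'' R'' by (auto simp: first_cols_def)
  have "first_cols A (Suc j) - ?Q'' * ?R'' = ?E + ?D"
    using A Q' R' Q'' R'' by (intro eq_matI) (auto simp: first_cols_def simp del: index_mult_mat(1))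
  then have "frob_norm (first_cols A (Suc j) - ?Q'' * ?R'') \<le> frob_norm ?E + frob_norm ?D"
    using frob_norm_triangle[OF E D] by simp
  also have "frob_norm ?E \<le> tol * real d * frob_norm ?R''"
    using extend_residual[OF delete.hyps(3) A jn Q R o] err mono by simp
  also have "frob_norm ?D \<le> tol * frob_norm ?R''"
    using frob_norm_deleted_part[OF Q' R' o' i] deleted_row_small[OF R' i delete.hyps(5) tol] by simp
  finally have "frob_norm (first_cols A (Suc j) - ?Q'' * ?R'') \<le> tol * real (Suc d) * frob_norm ?R''"
    by (simp add: algebra_simps)
  then show ?case
    using jn d Q'' R'' orthonormal_delete_col[OF Q' o'] by simp
qed

section \<open>Independence of the rows of the triangular factor\<close>

text \<open>
  Linear independence of the family of rows, with coefficients given by a function on indices rather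
  than by a vector: extending and deleting rows then changes coefficients pointwise.
\<close>
definition rows_independent :: "real mat \<Rightarrow> bool" where
  "rows_independent R \<longleftrightarrow>
     (\<forall>w. (\<forall>y<dim_col R. (\<Sum>c<dim_row R. w c * R $$ (c, y)) = 0) \<longrightarrow> (\<forall>c<dim_row R. w c = 0))"

lemma rows_independentD:
  assumes "rows_independent R" "R \<in> carrier_mat l j"
    and "\<And>y. y < j \<Longrightarrow> (\<Sum>c<l. w c * R $$ (c, y)) = 0" and "c < l"
  shows "w c = 0"
  using assms unfolding rows_independent_def by auto

lemma rows_independentI:
  assumes "R \<in> carrier_mat l j"
    and "\<And>w c. (\<And>y. y < j \<Longrightarrow> (\<Sum>c<l. w c * R $$ (c, y)) = 0) \<Longrightarrow> c < l \<Longrightarrow> w c = 0"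
  shows "rows_independent R"
  using assms unfolding rows_independent_def by auto

lemma rows_independent_transpose:
  assumes R: "R \<in> carrier_mat l j"
  shows "rows_independent R \<longleftrightarrow> (\<forall>w \<in> carrier_vec l. transpose_mat R *\<^sub>v w = 0\<^sub>v j \<longrightarrow> w = 0\<^sub>v l)"
proof
  assume ind: "rows_independent R"
  show "\<forall>w \<in> carrier_vec l. transpose_mat R *\<^sub>v w = 0\<^sub>v j \<longrightarrow> w = 0\<^sub>v l"
  proof (intro ballI impI)
    fix w :: "real vec" assume w: "w \<in> carrier_vec l" and zero: "transpose_mat R *\<^sub>v w = 0\<^sub>v j"
    have "(\<Sum>c<l. w $ c * R $$ (c, y)) = 0" if "y < j" for y
      using arg_cong[OF zero, of "\<lambda>v. v $ y"] that R w
      by (simp add: scalar_prod_def atLeast0LessThan mult.commute)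
    then have "w $ c = 0" if "c < l" for c
      using rows_independentD[OF ind R, of "\<lambda>c. w $ c"] that by blast
    then show "w = 0\<^sub>v l"
      using w by (intro eq_vecI) auto
  qed
next
  assume inj: "\<forall>w \<in> carrier_vec l. transpose_mat R *\<^sub>v w = 0\<^sub>v j \<longrightarrow> w = 0\<^sub>v l"
  show "rows_independent R"
  proof (rule rows_independentI[OF R])
    fix w c assume zero: "\<And>y. y < j \<Longrightarrow> (\<Sum>c<l. w c * R $$ (c, y)) = 0" and c: "c < l"
    have "transpose_mat R *\<^sub>v vec l w = 0\<^sub>v j"
      using R zero by (intro eq_vecI) (auto simp: scalar_prod_def atLeast0LessThan mult.commute)
    then have "vec l w = 0\<^sub>v l"
      using inj by simp
    then have "vec l w $ c = 0\<^sub>v l $ c"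
      by simp
    then show "w c = 0"
      using c by simp
  qed
qed

text \<open>
  A vector annihilated by \<open>R\<close> is annihilated by \<open>B = Q R\<close>, hence zero if \<open>B\<close> has full column rank. For the
  square matrix \<open>R\<close>, a trivial kernel passes to the transpose by way of the determinant.
\<close>
lemma rows_independent_initial:
  assumes qr: "is_qr B Q R" and B: "B \<in> carrier_mat m k"
    and rank: "vec_space.rank m B = k"
  shows "rows_independent R"
proof -
  interpret vec_space "TYPE(real)" m .
  have Q: "Q \<in> carrier_mat m k" and R: "R \<in> carrier_mat k k" and BQR: "B = Q * R"
    using qr B by (auto simp: is_qr_def)
  have "v = 0\<^sub>v k" if v: "v \<in> carrier_vec k" and zero: "R *\<^sub>v v = 0\<^sub>v k" for v
  proof (rule full_col_rank_injective[OF B rank v])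
    show "B *\<^sub>v v = 0\<^sub>v m"
      using Q unfolding BQR assoc_mult_mat_vec[OF Q R v] zero by (intro eq_vecI) auto
  qed
  then have "det R \<noteq> 0"
    using det_0_iff_vec_prod_zero_field[OF R] by auto
  then have "det (transpose_mat R) \<noteq> 0"
    using det_transpose[OF R] by simp
  then show ?thesis
    using det_0_iff_vec_prod_zero_field[of "transpose_mat R" k] R
    by (auto simp: rows_independent_transpose[OF R])
qed

text \<open>
  In a vanishing combination of the new rows, the first \<open>j\<close> columns involve only the old rows and so
  annihilate their coefficients; the last column then leaves \<open>\<rho>\<close> times the coefficient of the new row.
\<close>
lemma rows_independent_extend:
  assumes ind: "rows_independent R" and R: "R \<in> carrier_mat l j"
    and R': "R' \<in> carrier_mat (Suc l) (Suc j)"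
    and R'i: "\<forall>c<Suc l. \<forall>y<Suc j. R' $$ (c, y) =
       (if c < l then if y < j then R $$ (c, y) else r $ c else if y < j then 0 else \<rho>)"
    and \<rho>: "\<rho> \<noteq> 0"
  shows "rows_independent R'"
proof (rule rows_independentI[OF R'])
  fix w c assume zero: "\<And>y. y < Suc j \<Longrightarrow> (\<Sum>c<Suc l. w c * R' $$ (c, y)) = 0" and c: "c < Suc l"
  have lead: "w b = 0" if "b < l" for b
  proof (rule rows_independentD[OF ind R _ that])
    fix y assume "y < j"
    then show "(\<Sum>c<l. w c * R $$ (c, y)) = 0"
      using zero[of y] by (simp add: R'i)
  qed
  have "w l = 0"
    using zero[of j] lead \<rho> by (simp add: R'i)
  then show "w c = 0"
    using c lead by (cases "c = l") auto
qed

lemma rows_independent_delete: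
  assumes ind: "rows_independent R" and R: "R \<in> carrier_mat (Suc l) j" and i: "i < Suc l"
  shows "rows_independent (delete_row R i)"
proof (rule rows_independentI[OF delete_row_carrier[OF R]])
  fix w c assume zero: "\<And>y. y < j \<Longrightarrow> (\<Sum>c<l. w c * delete_row R i $$ (c, y)) = 0" and c: "c < l"
  \<comment> \<open>the same combination, on the indices before the deletion\<close>
  define w' where "w' b = (if b = i then 0 else if b = l then w i else w b)" for b
  have w': "w' (moved_index l i b) = w b" if "b < l" for b
    using that by (auto simp: w'_def moved_index_def)
  have "w' (moved_index l i c) = 0"
  proof (rule rows_independentD[OF ind R _ moved_index_less[OF c]])
    fix y assume y: "y < j"
    have "(\<Sum>c<l. w' (moved_index l i c) * R $$ (moved_index l i c, y)) = 0"
      using zero[OF y] y by (simp add: index_delete_row[OF R] w')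
    then show "(\<Sum>c<Suc l. w' c * R $$ (c, y)) = 0"
      using sum_moved_index[OF i, of "\<lambda>c. w' c * R $$ (c, y)"] by (simp add: w'_def)
  qed
  then show "w c = 0"
    using w'[OF c] by simp
qed

lemma rows_independent_no_zero_row:
  assumes ind: "rows_independent R" and R: "R \<in> carrier_mat l j" and i: "i < l"
  shows "\<exists>y<j. R $$ (i, y) \<noteq> 0"
proof (rule ccontr)
  assume "\<not> ?thesis"
  then have "(\<Sum>c<l. (if c = i then 1 else 0) * R $$ (c, y)) = 0" if "y < j" for y
    using that i by (simp add: if_distrib[of "\<lambda>t. t * _"] cong: if_cong)
  from rows_independentD[OF ind R this i] show False
    by simp
qed

lemma vec_norm2_row_eq_0_iff:
  "c < dim_row R \<Longrightarrow> vec_norm2 (row R c) = 0 \<longleftrightarrow> (\<forall>y<dim_col R. R $$ (c, y) = 0)"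
  unfolding zero_eq_power2[of "vec_norm2 (row R c)", symmetric] vec_norm2_row_sq
  by (auto simp: sum_nonneg_eq_0_iff)

lemma min_norm_row_eq_0:
  "min_norm_row R i \<Longrightarrow> p < dim_row R \<Longrightarrow> vec_norm2 (row R p) = 0 \<Longrightarrow> vec_norm2 (row R i) = 0"
  using vec_norm2_nonneg[of "row R i"] by (auto simp: min_norm_row_def intro: order_antisym)

text \<open>
  The delicate case is \<open>\<rho> = 0\<close>, in which the extended factor has dependent rows. The row of minimum norm
  is then zero. Such a row never passes the test, so the step deletes it; and as the old rows are
  independent, it can only be the last one, so that the old rows are kept, lengthened by the entries
  of \<open>r\<close>.
\<close>
lemma incremental_qr_rows_independent:
  assumes run: "incremental_qr A tol k\<^sub>0 j Q R d"
    and A: "A \<in> carrier_mat m n" and tol: "0 < tol"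
    and rank: "vec_space.rank m (first_cols A k\<^sub>0) = k\<^sub>0"
  shows "rows_independent R"
  using run
proof induction
  case (init Q R)
  have "first_cols A k\<^sub>0 \<in> carrier_mat m k\<^sub>0"
    using A by (simp add: first_cols_def)
  then show ?case
    using rows_independent_initial init.hyps(2) rank by blast
next
  case (keep j Q R d Q' R' i)
  let ?l = "j - d"
  have Q: "Q \<in> carrier_mat m ?l" and R: "R \<in> carrier_mat ?l j" and o: "orthonormal_cols Q"
    using incremental_qr_invariant[OF keep.hyps(1) A tol] by auto
  have a: "col A j \<in> carrier_vec m" using A keep.hyps(2) by auto
  obtain r \<rho> where
    R': "R' \<in> carrier_mat (Suc ?l) (Suc j)"
    and R'i: "\<forall>c<Suc ?l. \<forall>y<Suc j. R' $$ (c, y) =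
       (if c < ?l then if y < j then R $$ (c, y) else r $ c else if y < j then 0 else \<rho>)"
    by (rule gram_schmidt_extendE[OF keep.hyps(3) Q R a o]) (rule that; assumption)
  have "\<rho> \<noteq> 0"
  proof
    assume "\<rho> = 0"
    then have "vec_norm2 (row R' ?l) = 0"
      using R' by (simp add: vec_norm2_row_eq_0_iff R'i)
    then have "vec_norm2 (row R' i) = 0"
      using min_norm_row_eq_0[OF keep.hyps(4)] R' by auto
    then have "tol\<^sup>2 * (frob_norm R')\<^sup>2 < 0"
      using keep.hyps(5) by (simp add: keeps_row_def)
    then show False
      by (simp add: mult_less_0_iff)
  qed
  show ?case
    by (rule rows_independent_extend[OF keep.IH R R' R'i \<open>\<rho> \<noteq> 0\<close>])
next
  case (delete j Q R d Q' R' i)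
  let ?l = "j - d"
  have Q: "Q \<in> carrier_mat m ?l" and R: "R \<in> carrier_mat ?l j" and o: "orthonormal_cols Q"
    using incremental_qr_invariant[OF delete.hyps(1) A tol] by auto
  have a: "col A j \<in> carrier_vec m" using A delete.hyps(2) by auto
  obtain r \<rho> where
    R': "R' \<in> carrier_mat (Suc ?l) (Suc j)"
    and R'i: "\<forall>c<Suc ?l. \<forall>y<Suc j. R' $$ (c, y) =
       (if c < ?l then if y < j then R $$ (c, y) else r $ c else if y < j then 0 else \<rho>)"
    by (rule gram_schmidt_extendE[OF delete.hyps(3) Q R a o]) (rule that; assumption)
  have i: "i < Suc ?l"
    using delete.hyps(4) R' by (simp add: min_norm_row_def)
  show ?case
  proof (cases "\<rho> = 0")
    case False
    then show ?thesis
      using rows_independent_delete[OF rows_independent_extend[OF delete.IH R R' R'i False] R' i] by simp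
  next
    case True
    then have "vec_norm2 (row R' ?l) = 0"
      using R' by (simp add: vec_norm2_row_eq_0_iff R'i)
    then have "vec_norm2 (row R' i) = 0"
      using min_norm_row_eq_0[OF delete.hyps(4)] R' by auto
    then have zero: "R' $$ (i, y) = 0" if "y < j" for y
      using R' i that by (simp add: vec_norm2_row_eq_0_iff)
    have last: "i = ?l"
    proof (rule ccontr)
      assume "i \<noteq> ?l"
      then have "i < ?l" using i by simp
      from rows_independent_no_zero_row[OF delete.IH R this]
      obtain y where "y < j" "R $$ (i, y) \<noteq> 0" by blast
      then show False
        using zero[of y] \<open>i < ?l\<close> by (simp add: R'i)
    qed
    show ?thesis
    proof (rule rows_independentI[OF delete_row_carrier[OF R']])
      fix w c
      assume comb: "\<And>y. y < Suc j \<Longrightarrow> (\<Sum>c<?l. w c * delete_row R' i $$ (c, y)) = 0" and c: "c < ?l"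
      show "w c = 0"
      proof (rule rows_independentD[OF delete.IH R _ c])
        fix y assume "y < j"
        then show "(\<Sum>c<?l. w c * R $$ (c, y)) = 0"
          using comb[of y] by (simp add: index_delete_row[OF R'] last moved_index_def R'i)
      qed
    qed
  qed
qed

section \<open>Rank of the product\<close>

text \<open>
  The right inverse is \<open>R\<^sup>T (R R\<^sup>T)\<^sup>-\<^sup>1\<close>. The Gram matrix \<open>R R\<^sup>T\<close> is nonsingular because
  \<open>R R\<^sup>T w = 0\<close> makes the squared norm \<open>w \<bullet> (R R\<^sup>T w)\<close> of \<open>R\<^sup>T w\<close> vanish.
\<close>
lemma rows_independent_right_inverse:
  assumes ind: "rows_independent R" and R: "R \<in> carrier_mat l j"
  obtains X where "X \<in> carrier_mat j l" "R * X = 1\<^sub>m l"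
proof -
  let ?G = "R * transpose_mat R"
  have G: "?G \<in> carrier_mat l l" using R by auto
  have "w = 0\<^sub>v l" if w: "w \<in> carrier_vec l" and zero: "?G *\<^sub>v w = 0\<^sub>v l" for w
  proof -
    let ?u = "transpose_mat R *\<^sub>v w"
    have u: "?u \<in> carrier_vec j" using R w by auto
    have "?u \<bullet> ?u = w \<bullet> (R *\<^sub>v ?u)"
      using transpose_vec_mult_scalar[OF R u w] comm_scalar_prod by auto
    also have "R *\<^sub>v ?u = 0\<^sub>v l"
      using zero R w by (simp add: assoc_mult_mat_vec[of R l j])
    finally have "vec_norm2 ?u = 0"
      using w by (simp add: vec_norm2_def)
    then have "?u = 0\<^sub>v j"
      using u vec_norm2_eq_0_iff[of ?u] by (metis carrier_vecD)
    then show ?thesis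
      using ind w unfolding rows_independent_transpose[OF R] by blast
  qed
  then have "det ?G \<noteq> 0"
    using det_0_iff_vec_prod_zero_field[OF G] by auto
  from det_non_zero_imp_unit[OF G this, of "()"]
  obtain Y where "Y \<in> carrier_mat l l" "?G * Y = 1\<^sub>m l"
    unfolding Units_def ring_mat_def by auto
  then have "R * (transpose_mat R * Y) = 1\<^sub>m l"
    using R assoc_mult_mat[of R l j "transpose_mat R" l Y l] by simp
  moreover have "transpose_mat R * Y \<in> carrier_mat j l"
    using R \<open>Y \<in> carrier_mat l l\<close> by auto
  ultimately show thesis
    using that by blast
qed

lemma rank_orthonormal_cols:
  assumes Q: "Q \<in> carrier_mat m l" and o: "orthonormal_cols Q"
  shows "vec_space.rank m Q = l"
proof (rule vec_space.injective_full_col_rank[OF Q])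
  fix v :: "real vec" assume v: "v \<in> carrier_vec l" and zero: "Q *\<^sub>v v = 0\<^sub>v m"
  have "v = (transpose_mat Q * Q) *\<^sub>v v"
    using v transpose_mult_orthonormal[OF Q o] by simp
  also have "\<dots> = transpose_mat Q *\<^sub>v (Q *\<^sub>v v)"
    using Q v by (intro assoc_mult_mat_vec) auto
  also have "\<dots> = 0\<^sub>v l"
    using Q unfolding zero by (intro eq_vecI) auto
  finally show "v = 0\<^sub>v l" .
qed

text \<open>
  Multiplication from the right cannot increase the rank. With a right inverse \<open>X\<close> of \<open>R\<close> this applies in
  both directions, to \<open>Q R\<close> and to \<open>Q = (Q R) X\<close>.
\<close>
lemma rank_orthonormal_mult_rows_independent:
  assumes Q: "Q \<in> carrier_mat m l" and R: "R \<in> carrier_mat l j"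
    and o: "orthonormal_cols Q" and ind: "rows_independent R"
  shows "vec_space.rank m (Q * R) = l"
proof (rule antisym)
  show "vec_space.rank m (Q * R) \<le> l"
    using vec_space.rank_mult_le_left[OF Q R] rank_orthonormal_cols[OF Q o] by simp
  obtain X where X: "X \<in> carrier_mat j l" and RX: "R * X = 1\<^sub>m l"
    using rows_independent_right_inverse[OF ind R] .
  have "Q * R * X = Q"
    using Q unfolding assoc_mult_mat[OF Q R X] RX by simp
  then have "vec_space.rank m Q \<le> vec_space.rank m (Q * R)"
    using vec_space.rank_mult_le_left[of "Q * R" m j X l] Q R X by simp
  then show "l \<le> vec_space.rank m (Q * R)"
    using rank_orthonormal_cols[OF Q o] by simp
qed

theorem lemma5p1:
  fixes A Q R :: "real mat" and m n k\<^sub>0 j d :: nat and tol :: real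
  assumes "A \<in> carrier_mat m n" and "n \<le> m" and "0 < tol"
    and "incremental_qr A tol k\<^sub>0 j Q R d"
  shows "frob_norm (first_cols A j - Q * R) \<le> tol * real d * frob_norm R
    \<and> orthonormal_cols Q
    \<and> d \<le> j \<and> Q \<in> carrier_mat m (j - d) \<and> R \<in> carrier_mat (j - d) j
    \<and> (j = n \<and> vec_space.rank m (first_cols A k\<^sub>0) = k\<^sub>0
         \<longrightarrow> d = min m n - vec_space.rank m (Q * R))"
proof -
  note inv = incremental_qr_invariant[OF assms(4,1,3)]
  have "d = min m n - vec_space.rank m (Q * R)"
    if "j = n" "vec_space.rank m (first_cols A k\<^sub>0) = k\<^sub>0"
  proof -
    have "rows_independent R"
      using incremental_qr_rows_independent[OF assms(4,1,3) that(2)] .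
    then have "vec_space.rank m (Q * R) = n - d"
      using rank_orthonormal_mult_rows_independent inv that(1) by blast
    then show ?thesis
      using inv that(1) assms(2) by simp
  qed
  then show ?thesis
    using inv by blast
qed

end
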